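(* Let the ruled surfaces $\varphi_e$ and $\varphi_{e_1}$ form a Mannheim surface offset, with dual offset angle $\bar\theta=\theta+\varepsilon\theta^*$. Then the dual spherical radius of curvature $\bar\rho_1$ of $\varphi_{e_1}$ is equal to the dual offset angle, i.e. $$\bar\rho_1=\bar\theta.$$
   Context: Dual numbers: $D=\{a+\varepsilon a^*: a,a^*\in\mathbb{R}\}$ with $\varepsilon^2=0$. A differentiable real function $f$ extends to $D$ by $f(x+\varepsilon x^* )=f(x)+\varepsilon x^* f'(x)$; in particular this defines $\sin$, $\cos$, and $\sqrt{\cdot}$ (for $x>0$). Dual vectors are $\tilde a=\vec a+\varepsilon\vec a^*$ with $\vec a,\vec a^*\in\mathbb{R}^3$; scalar and cross products are extended $D$-bilinearly. Ruled surface: all functions are smooth. $\varphi_e(s,v)=\vec c(s)+v\,\vec e(s)$, $s$ in an open interval, where $\langle\vec e,\vec e\rangle=1$, $s$ is the arc-length of the spherical curve $\vec e$, i.e. $\langle\vec e\,',\vec e\,'\rangle=1$, and $\vec c$ is the striction curve, i.e. $\langle\vec c\,',\vec e\,'\rangle=0$ (prime $=d/ds$). Put $\vec t=\vec e\,'$, $\vec g=\vec e\times\vec t$. The conical curvature $\gamma$ is defined by $\vec t\,'=\gamma\vec g-\vec e$ (so $\vec g\,'=-\gamma\vec t$). Put $\Delta=\det(\vec c\,',\vec e,\vec t)$, $\delta=\langle\vec c\,',\vec e\rangle$ and $\bar\gamma=\gamma+\varepsilon(\delta-\gamma\Delta)$. The ruled surface is represented by the dual unit vector $\tilde e=\vec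 e+\varepsilon\,\vec c\times\vec e$; its dual Darboux frame is $\{\tilde e,\tilde t,\tilde g\}$ with $\tilde t=\vec t+\varepsilon\,\vec c\times\vec t$, $\tilde g=\vec g+\varepsilon\,\vec c\times\vec g$. Dual spherical radius of curvature: the dual angle $\bar\rho=\rho+\varepsilon\rho^*$ ($0\le\rho\le\pi$) between $\tilde e$ and the unit dual Darboux vector $\tilde d_o=\frac{\bar\gamma}{\sqrt{1+\bar\gamma^2}}\tilde e+\frac{1}{\sqrt{1+\bar\gamma^2}}\tilde g$, determined by $\cos\bar\rho=\frac{\bar\gamma}{\sqrt{1+\bar\gamma^2}}$, $\sin\bar\rho=\frac{1}{\sqrt{1+\bar\gamma^2}}$. A second ruled surface $\varphi_{e_1}$ is given in the same way; the same symbols with index $1$ ($s_1,\vec c_1,\vec e_1,\vec t_1,\vec g_1,\gamma_1,\Delta_1,\delta_1,\bar\gamma_1,\bar\rho_1,\tilde e_1,\tilde t_1,\tilde g_1$) denote its corresponding objects, with derivatives taken with respect to $s_1$. Mannheim surface offset: $\varphi_e$ and $\varphi_{e_1}$ are Mannheim surface offsets if there is a one-to-one correspondence $s\mapsto s_1(s)$ between their rulings (smooth, with $ds_1/ds\neq0$) such that $\tilde g=\tilde t_1$ at corresponding parameters. Then the frames are related by $\tilde e_1=\cos\bar\theta\,\tilde e+\sin\bar\theta\,\tilde t$, $\tilde t_1=\tilde g$, $\tilde g_1=\sin\bar\theta\,\tilde e-\cos\bar\theta\,\tilde t$, where $\bar\theta=\theta+\varepsilon\theta^*$ (a smooth function of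 $s$, with $0\le\theta\le\pi$, $\theta^*\in\mathbb{R}$) is the dual angle between $\tilde e$ and $\tilde e_1$, called the dual offset angle. *)

theory Defs
  imports "HOL-Analysis.Analysis"
begin

section \<open>Dual numbers and dual vectors\<close>

text \<open>\<open>Dual a b\<close> is \<open>a + \<epsilon> b\<close> with \<open>\<epsilon>\<^sup>2 = 0\<close>: dual numbers are \<open>real dual\<close>, dual vectors are
  \<open>(real^3) dual\<close>.\<close>

datatype 'a dual = Dual (re: 'a) (du: 'a)

definition dual_bilinear :: "('a \<Rightarrow> 'b \<Rightarrow> 'c::plus) \<Rightarrow> 'a dual \<Rightarrow> 'b dual \<Rightarrow> 'c dual" where
  "dual_bilinear B x y = Dual (B (re x) (re y)) (B (re x) (du y) + B (du x) (re y))"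

definition dual_extend ::
    "('a::real_normed_field \<Rightarrow> 'a) \<Rightarrow> 'a dual \<Rightarrow> 'a dual" where
  "dual_extend f x = Dual (f (re x)) (du x * deriv f (re x))"

instantiation dual :: (ab_group_add) ab_group_add
begin
definition "0 = Dual 0 0"
definition "x + y = Dual (re x + re y) (du x + du y)"
definition "- x = Dual (- re x) (- du x)"
definition "x - y = Dual (re x - re y) (du x - du y)"
instance
  by standard
    (simp_all add: zero_dual_def plus_dual_def uminus_dual_def minus_dual_def algebra_simps)
end

instantiation dual :: (comm_ring_1) comm_ring_1
begin
definition "1 = Dual 1 0"
definition "x * y = dual_bilinear (*) x y" for x y :: "'a dual"
instance
  by standard
    (simp_all add: zero_dual_def one_dual_def plus_dual_def times_dual_def dual_bilinear_def
      algebra_simps)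
end

text \<open>The inverse is meaningful only for dual numbers with nonzero real part.\<close>

instantiation dual :: (real_normed_field) inverse
begin
definition "inverse x = dual_extend inverse x" for x :: "'a dual"
definition "x div y = x * inverse y" for x y :: "'a dual"
instance ..
end

definition dual_cos :: "real dual \<Rightarrow> real dual" where "dual_cos = dual_extend cos"
definition dual_sin :: "real dual \<Rightarrow> real dual" where "dual_sin = dual_extend sin"
definition dual_sqrt :: "real dual \<Rightarrow> real dual" where "dual_sqrt = dual_extend sqrt"

definition dual_scale :: "real dual \<Rightarrow> (real^3) dual \<Rightarrow> (real^3) dual" where
  "dual_scale = dual_bilinear (*\<^sub>R)"

definition dual_inner :: "(real^3) dual \<Rightarrow> (real^3) dual \<Rightarrow> real dual" where
  "dual_inner = dual_bilinear (\<bullet>)"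

definition dual_cross :: "(real^3) dual \<Rightarrow> (real^3) dual \<Rightarrow> (real^3) dual" where
  "dual_cross = dual_bilinear cross3"

section \<open>Ruled surfaces\<close>

abbreviation vderiv :: "(real \<Rightarrow> 'a::real_normed_vector) \<Rightarrow> real \<Rightarrow> 'a" where
  "vderiv f \<equiv> (\<lambda>s. vector_derivative f (at s))"

definition smooth_on :: "real set \<Rightarrow> (real \<Rightarrow> 'a::real_normed_vector) \<Rightarrow> bool" where
  "smooth_on I f \<longleftrightarrow> (\<forall>n. \<forall>s\<in>I. (vderiv ^^ n) f differentiable (at s))"

text \<open>The surface \<open>(s, v) \<mapsto> c s + v *\<^sub>R e s\<close>, \<open>s \<in> I\<close>, given by its striction curve \<open>c\<close> and
  the spherical curve \<open>e\<close> of its rulings, which is parametrized by arc length.\<close>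

definition ruled_surface ::
    "real set \<Rightarrow> (real \<Rightarrow> real^3) \<Rightarrow> (real \<Rightarrow> real^3) \<Rightarrow> bool" where
  "ruled_surface I c e \<longleftrightarrow>
     open I \<and> is_interval I \<and> I \<noteq> {} \<and> smooth_on I c \<and> smooth_on I e \<and>
     (\<forall>s\<in>I. e s \<bullet> e s = 1 \<and> vderiv e s \<bullet> vderiv e s = 1 \<and> vderiv c s \<bullet> vderiv e s = 0)"

definition tangent :: "(real \<Rightarrow> real^3) \<Rightarrow> real \<Rightarrow> real^3" where
  "tangent e s = vderiv e s"

definition central_normal :: "(real \<Rightarrow> real^3) \<Rightarrow> real \<Rightarrow> real^3" where
  "central_normal e s = cross3 (e s) (tangent e s)"

definition conical_curvature :: "(real \<Rightarrow> real^3) \<Rightarrow> real \<Rightarrow> real" where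
  "conical_curvature e s =
     (THE k. vderiv (tangent e) s = k *\<^sub>R central_normal e s - e s)"

definition Delta :: "(real \<Rightarrow> real^3) \<Rightarrow> (real \<Rightarrow> real^3) \<Rightarrow> real \<Rightarrow> real" where
  "Delta c e s = det (vector [vderiv c s, e s, tangent e s] :: real^3^3)"

definition delta :: "(real \<Rightarrow> real^3) \<Rightarrow> (real \<Rightarrow> real^3) \<Rightarrow> real \<Rightarrow> real" where
  "delta c e s = vderiv c s \<bullet> e s"

definition dual_conical_curvature ::
    "(real \<Rightarrow> real^3) \<Rightarrow> (real \<Rightarrow> real^3) \<Rightarrow> real \<Rightarrow> real dual" where
  "dual_conical_curvature c e s =
     Dual (conical_curvature e s) (delta c e s - conical_curvature e s * Delta c e s)"

definition dual_e :: "(real \<Rightarrow> real^3) \<Rightarrow> (real \<Rightarrow> real^3) \<Rightarrow> real \<Rightarrow> (real^3) dual" where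
  "dual_e c e s = Dual (e s) (cross3 (c s) (e s))"

definition dual_t :: "(real \<Rightarrow> real^3) \<Rightarrow> (real \<Rightarrow> real^3) \<Rightarrow> real \<Rightarrow> (real^3) dual" where
  "dual_t c e s = Dual (tangent e s) (cross3 (c s) (tangent e s))"

definition dual_g :: "(real \<Rightarrow> real^3) \<Rightarrow> (real \<Rightarrow> real^3) \<Rightarrow> real \<Rightarrow> (real^3) dual" where
  "dual_g c e s = Dual (central_normal e s) (cross3 (c s) (central_normal e s))"

definition unit_dual_Darboux ::
    "(real \<Rightarrow> real^3) \<Rightarrow> (real \<Rightarrow> real^3) \<Rightarrow> real \<Rightarrow> (real^3) dual" where
  "unit_dual_Darboux c e s =
     (let k = dual_conical_curvature c e s
      in dual_scale (k / dual_sqrt (1 + k\<^sup>2)) (dual_e c e s)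
         + dual_scale (1 / dual_sqrt (1 + k\<^sup>2)) (dual_g c e s))"

text \<open>The dual spherical radius of curvature is the dual angle between \<open>dual_e\<close> and
  \<open>unit_dual_Darboux\<close>, determined by its cosine and its sine.\<close>

definition dual_spherical_radius ::
    "(real \<Rightarrow> real^3) \<Rightarrow> (real \<Rightarrow> real^3) \<Rightarrow> real \<Rightarrow> real dual" where
  "dual_spherical_radius c e s =
     (THE r. 0 \<le> re r \<and> re r \<le> pi \<and>
        (let k = dual_conical_curvature c e s
         in dual_cos r = k / dual_sqrt (1 + k\<^sup>2) \<and> dual_sin r = 1 / dual_sqrt (1 + k\<^sup>2)))"

section \<open>Mannheim offsets\<close>

text \<open>\<open>\<sigma>\<close> is the correspondence between the rulings of the two surfaces.\<close>

definition mannheim_offset ::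
    "real set \<Rightarrow> (real \<Rightarrow> real^3) \<Rightarrow> (real \<Rightarrow> real^3) \<Rightarrow>
     real set \<Rightarrow> (real \<Rightarrow> real^3) \<Rightarrow> (real \<Rightarrow> real^3) \<Rightarrow> (real \<Rightarrow> real) \<Rightarrow> bool" where
  "mannheim_offset I c e I1 c1 e1 \<sigma> \<longleftrightarrow>
     bij_betw \<sigma> I I1 \<and> smooth_on I \<sigma> \<and> (\<forall>s\<in>I. vderiv \<sigma> s \<noteq> 0) \<and>
     (\<forall>s\<in>I. dual_g c e s = dual_t c1 e1 (\<sigma> s))"

text \<open>For a Mannheim offset the first rulings are related by
  \<open>dual_e1 = cos \<theta> dual_e + sin \<theta> dual_t\<close>, which fixes the orientation of the dual angle \<open>\<theta>\<close>
  from \<open>dual_e\<close> to \<open>dual_e1\<close>. The relation \<open>dual_g1 = sin \<theta> dual_e - cos \<theta> dual_t\<close> is then a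
  consequence of \<open>dual_g1 = dual_e1 \<times> dual_t1\<close> and need not be required.\<close>

definition dual_offset_angle ::
    "real set \<Rightarrow> (real \<Rightarrow> real^3) \<Rightarrow> (real \<Rightarrow> real^3) \<Rightarrow>
     (real \<Rightarrow> real^3) \<Rightarrow> (real \<Rightarrow> real^3) \<Rightarrow> (real \<Rightarrow> real) \<Rightarrow> (real \<Rightarrow> real dual) \<Rightarrow> bool" where
  "dual_offset_angle I c e c1 e1 \<sigma> \<theta> \<longleftrightarrow>
     smooth_on I (\<lambda>s. re (\<theta> s)) \<and> smooth_on I (\<lambda>s. du (\<theta> s)) \<and>
     (\<forall>s\<in>I. 0 \<le> re (\<theta> s) \<and> re (\<theta> s) \<le> pi \<and>
        dual_e c1 e1 (\<sigma> s) =
          dual_scale (dual_cos (\<theta> s)) (dual_e c e s) + dual_scale (dual_sin (\<theta> s)) (dual_t c e s))"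

section \<open>Well-definedness\<close>

lemma central_normal_unit:
  assumes "ruled_surface I c e" "s \<in> I"
  shows "e s \<bullet> tangent e s = 0" "central_normal e s \<bullet> central_normal e s = 1"
    "(e has_vector_derivative tangent e s) (at s)"
    "(tangent e has_vector_derivative vderiv (tangent e) s) (at s)"
proof -
  have sm: "smooth_on I e" and I: "open I" and u: "\<And>s. s \<in> I \<Longrightarrow> e s \<bullet> e s = 1"
    and t: "tangent e s \<bullet> tangent e s = 1"
    using assms by (auto simp: ruled_surface_def tangent_def)
  have "(vderiv ^^ 0) e differentiable (at s)" "(vderiv ^^ 1) e differentiable (at s)"
    using sm assms(2) unfolding smooth_on_def by blast+
  then show de: "(e has_vector_derivative tangent e s) (at s)"
    and "(tangent e has_vector_derivative vderiv (tangent e) s) (at s)"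
    by (simp_all add: tangent_def [abs_def] vector_derivative_works)
  have "((\<lambda>s. e s \<bullet> e s) has_vector_derivative (e s \<bullet> tangent e s + tangent e s \<bullet> e s)) (at s)"
    by (rule bounded_bilinear.has_vector_derivative [OF bounded_bilinear_inner de de])
  moreover have "((\<lambda>s. e s \<bullet> e s) has_vector_derivative 0) (at s)"
    by (rule has_vector_derivative_transform_within_open [OF _ I assms(2), where f = "\<lambda>_. 1"])
      (auto simp: u)
  ultimately show et: "e s \<bullet> tangent e s = 0"
    using vector_derivative_unique_at by (fastforce simp: inner_commute)
  show "central_normal e s \<bullet> central_normal e s = 1"
    using u [OF assms(2)] t et
    by (simp add: central_normal_def dot_cross inner_commute)
qed

lemma conical_curvature_works:
  assumes "ruled_surface I c e" "s \<in> I"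
  shows "vderiv (tangent e) s = conical_curvature e s *\<^sub>R central_normal e s - e s"
proof -
  have I: "open I" and u: "e s \<bullet> e s = 1" and t: "\<And>s. s \<in> I \<Longrightarrow> tangent e s \<bullet> tangent e s = 1"
    using assms by (auto simp: ruled_surface_def tangent_def)
  note n = central_normal_unit [OF assms]
  have "((\<lambda>s. tangent e s \<bullet> tangent e s) has_vector_derivative
      (tangent e s \<bullet> vderiv (tangent e) s + vderiv (tangent e) s \<bullet> tangent e s)) (at s)"
    by (rule bounded_bilinear.has_vector_derivative [OF bounded_bilinear_inner n(4) n(4)])
  moreover have "((\<lambda>s. tangent e s \<bullet> tangent e s) has_vector_derivative 0) (at s)"
    by (rule has_vector_derivative_transform_within_open [OF _ I assms(2), where f = "\<lambda>_. 1"])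
      (auto simp: t)
  ultimately have tt: "vderiv (tangent e) s \<bullet> tangent e s = 0"
    using vector_derivative_unique_at by (fastforce simp: inner_commute)
  have "((\<lambda>s. e s \<bullet> tangent e s) has_vector_derivative
      (e s \<bullet> vderiv (tangent e) s + tangent e s \<bullet> tangent e s)) (at s)"
    by (rule bounded_bilinear.has_vector_derivative [OF bounded_bilinear_inner n(3) n(4)])
  moreover have "((\<lambda>s. e s \<bullet> tangent e s) has_vector_derivative 0) (at s)"
    by (rule has_vector_derivative_transform_within_open [OF _ I assms(2), where f = "\<lambda>_. 0"])
      (auto simp: central_normal_unit [OF assms(1)])
  ultimately have te: "vderiv (tangent e) s \<bullet> e s = - 1"
    using vector_derivative_unique_at t [OF assms(2)] by (fastforce simp: inner_commute)
  define x where "x = vderiv (tangent e) s + e s"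
  have "x \<bullet> e s = 0" "x \<bullet> tangent e s = 0"
    using tt te u n(1) by (simp_all add: x_def inner_add_left)
  then have "cross3 x (central_normal e s) = 0"
    by (simp add: central_normal_def Lagrange)
  then have "cross3 (central_normal e s) (cross3 x (central_normal e s)) = 0"
    by simp
  then have x: "x = (central_normal e s \<bullet> x) *\<^sub>R central_normal e s"
    using n(2) by (simp add: Lagrange)
  show ?thesis unfolding conical_curvature_def
  proof (rule theI)
    show eq: "vderiv (tangent e) s = (central_normal e s \<bullet> x) *\<^sub>R central_normal e s - e s"
      unfolding x [symmetric] by (simp add: x_def)
    fix k assume "vderiv (tangent e) s = k *\<^sub>R central_normal e s - e s"
    with eq have "k *\<^sub>R central_normal e s = (central_normal e s \<bullet> x) *\<^sub>R central_normal e s"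
      by (metis diff_add_cancel)
    then show "k = central_normal e s \<bullet> x"
      using n(2) by auto
  qed
qed

lemma deriv_sin_real: "deriv sin x = cos (x::real)"
  and deriv_cos_real: "deriv cos x = - sin (x::real)"
  by (rule DERIV_imp_deriv, auto intro!: derivative_eq_intros)+

lemma dual_radius_ex1:
  fixes k :: "real dual"
  shows "\<exists>!r. 0 \<le> re r \<and> re r \<le> pi \<and>
     dual_cos r = k / dual_sqrt (1 + k\<^sup>2) \<and> dual_sin r = 1 / dual_sqrt (1 + k\<^sup>2)"
proof -
  obtain a b where k: "k = Dual a b" by (cases k)
  define w where "w = sqrt (1 + a\<^sup>2)"
  have w: "w > 0" "w\<^sup>2 = 1 + a\<^sup>2"
    by (simp_all add: w_def add_pos_nonneg)
  have "(sqrt has_real_derivative inverse w / 2) (at (1 + a\<^sup>2))"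
    unfolding w_def by (rule DERIV_real_sqrt) (simp add: add_pos_nonneg)
  then have ds: "deriv sqrt (1 + a\<^sup>2) = inverse w / 2"
    by (rule DERIV_imp_deriv)
  have di: "deriv inverse w = - (1 / w\<^sup>2)"
    by (rule DERIV_imp_deriv) (use w(1) in \<open>auto intro!: derivative_eq_intros simp: power2_eq_square field_simps\<close>)
  have k2: "1 + k\<^sup>2 = Dual (1 + a\<^sup>2) (2 * a * b)"
    by (simp add: k power2_eq_square one_dual_def plus_dual_def times_dual_def dual_bilinear_def)
  have sq: "dual_sqrt (1 + k\<^sup>2) = Dual w (a * b / w)"
    by (simp add: k2 dual_sqrt_def dual_extend_def ds w_def [symmetric] field_simps)
  have inv: "1 / dual_sqrt (1 + k\<^sup>2) = Dual (1 / w) (- (a * b / w ^ 3))"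
    unfolding sq divide_dual_def inverse_dual_def dual_extend_def
    using w(1) by (simp add: di field_simps power3_eq_cube power2_eq_square)
  have "b / w - a * (a * b / w ^ 3) = b * (w\<^sup>2 - a\<^sup>2) / w ^ 3"
    using w(1) by (simp add: field_simps power3_eq_cube power2_eq_square)
  then have bw: "b / w - a * (a * b / w ^ 3) = b / w ^ 3"
    by (simp add: w(2))
  have "k / dual_sqrt (1 + k\<^sup>2) = k * (1 / dual_sqrt (1 + k\<^sup>2))"
    by (simp add: divide_dual_def)
  also have "\<dots> = Dual (a / w) (b / w ^ 3)"
    unfolding inv bw [symmetric] by (simp add: k times_dual_def dual_bilinear_def)
  finally have quo: "k / dual_sqrt (1 + k\<^sup>2) = Dual (a / w) (b / w ^ 3)" .
  have "(a / w)\<^sup>2 + (1 / w)\<^sup>2 = 1"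
    using w(1) by (simp add: power_divide add_divide_distrib [symmetric] add.commute flip: w(2))
  then obtain p where p: "0 \<le> p" "p \<le> pi" "a / w = cos p" "1 / w = sin p"
    using sincos_total_pi [of "1 / w" "a / w"] w(1) by auto
  have pu: "q = p" if "0 \<le> q" "q \<le> pi" "cos q = cos p" for q
    using that p cos_inj_pi by blast
  have ext: "dual_cos r = Dual (cos (re r)) (- (du r * sin (re r)))"
    "dual_sin r = Dual (sin (re r)) (du r * cos (re r))" for r
    by (simp_all add: dual_cos_def dual_sin_def dual_extend_def deriv_sin_real deriv_cos_real)
  show ?thesis
    unfolding quo inv
  proof (rule ex1I [of _ "Dual p (- (b / w\<^sup>2))"])
    show "0 \<le> re (Dual p (- (b / w\<^sup>2))) \<and> re (Dual p (- (b / w\<^sup>2))) \<le> pi \<and>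
      dual_cos (Dual p (- (b / w\<^sup>2))) = Dual (a / w) (b / w ^ 3) \<and>
      dual_sin (Dual p (- (b / w\<^sup>2))) = Dual (1 / w) (- (a * b / w ^ 3))"
      using p(1,2) by (simp add: ext p(3,4) [symmetric] field_simps power3_eq_cube power2_eq_square)
  next
    fix r
    assume r: "0 \<le> re r \<and> re r \<le> pi \<and> dual_cos r = Dual (a / w) (b / w ^ 3) \<and>
      dual_sin r = Dual (1 / w) (- (a * b / w ^ 3))"
    then have rp: "re r = p"
      using pu p(3) by (simp add: ext)
    with r p(4) have "- (du r * (1 / w)) = b / w ^ 3"
      by (simp add: ext)
    then have "du r = - (b / w\<^sup>2)"
      using w(1) by (simp add: field_simps power3_eq_cube power2_eq_square)
    with rp show "r = Dual p (- (b / w\<^sup>2))"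
      by (cases r) simp
  qed
qed

lemma dual_spherical_radius_works:
  fixes c e :: "real \<Rightarrow> real^3" and s :: real
  defines "r \<equiv> dual_spherical_radius c e s" and "k \<equiv> dual_conical_curvature c e s"
  shows "0 \<le> re r" "re r \<le> pi"
    "dual_cos r = k / dual_sqrt (1 + k\<^sup>2)" "dual_sin r = 1 / dual_sqrt (1 + k\<^sup>2)"
  using theI' [OF dual_radius_ex1 [of k]]
  unfolding r_def k_def dual_spherical_radius_def Let_def by auto

text \<open>The dual spherical radius is indeed an angle between \<open>dual_e\<close> and \<open>unit_dual_Darboux\<close>.\<close>

lemma dual_inner_e_Darboux:
  assumes "ruled_surface I c e" "s \<in> I"
  shows "dual_inner (dual_e c e s) (unit_dual_Darboux c e s) = dual_cos (dual_spherical_radius c e s)"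
proof -
  have u: "e s \<bullet> e s = 1"
    using assms by (auto simp: ruled_surface_def)
  have g: "e s \<bullet> central_normal e s = 0"
    by (simp add: central_normal_def dot_cross_self)
  have cg: "e s \<bullet> cross3 (c s) (central_normal e s) + cross3 (c s) (e s) \<bullet> central_normal e s = 0"
    by (simp add: cross3_def inner_vec_def sum_3 vector_3 algebra_simps)
  have ee: "e s \<bullet> cross3 (c s) (e s) = 0" "cross3 (c s) (e s) \<bullet> e s = 0"
    by (simp_all add: dot_cross_self)
  have *: "dual_inner (dual_e c e s)
      (dual_scale p (dual_e c e s) + dual_scale q (dual_g c e s)) = p" for p q
    using arg_cong [OF cg, of "\<lambda>x. re q * x"]
    by (cases p) (simp add: dual_inner_def dual_scale_def dual_bilinear_def dual_e_def dual_g_def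
        plus_dual_def inner_add_right inner_add_left u g ee algebra_simps)
  show ?thesis
    by (simp add: unit_dual_Darboux_def Let_def * dual_spherical_radius_works(3))
qed

lemma dual_g_eq_cross: "dual_g c e s = dual_cross (dual_e c e s) (dual_t c e s)"
  by (simp add: dual_cross_def dual_bilinear_def dual_g_def dual_e_def dual_t_def central_normal_def)
    (simp add: cross3_def vec_eq_iff forall_3 vector_3 algebra_simps)

end

theory Submission
  imports Defs
begin

text \<open>
  The moving dual frame of a ruled surface satisfies Frenet-type equations over the dual numbers.
  With \<open>\<omega> = 1 + \<epsilon> \<Delta>\<close>, the dual speed of the curve \<open>dual_e\<close>, they say \<open>t' = \<omega> (k g - e)\<close> and
  \<open>g' = - \<omega> k t\<close>, where \<open>k\<close> is the dual conical curvature (\<open>dual_t_has_dual_derivative\<close>,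
  \<open>dual_g_has_dual_derivative\<close>). Along a Mannheim offset \<open>g = t\<^sub>1 \<circ> \<sigma>\<close>; differentiating gives
  \<open>- \<omega> k t = \<sigma>' \<omega>\<^sub>1 (k\<^sub>1 g\<^sub>1 - e\<^sub>1)\<close>, so \<open>k\<^sub>1 g\<^sub>1 - e\<^sub>1\<close> has no component along \<open>e\<close>, because
  \<open>\<sigma>' \<omega>\<^sub>1\<close> has nonzero real part and may be cancelled. Since \<open>e\<^sub>1 = cos \<theta> e + sin \<theta> t\<close> and
  \<open>g\<^sub>1 = e\<^sub>1 \<times> t\<^sub>1 = sin \<theta> e - cos \<theta> t\<close>, that component is \<open>k\<^sub>1 sin \<theta> - cos \<theta>\<close>. So
  \<open>cos \<theta> = k\<^sub>1 sin \<theta>\<close> (\<open>mannheim_offset_cot\<close>): the dual cotangent of the offset angle is \<open>k\<^sub>1\<close>.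

  The defining equations of the dual spherical radius give it the same dual cotangent, and a dual
  angle with real part between \<open>0\<close> and \<open>\<pi>\<close> is determined by its cotangent
  (\<open>dual_angle_eq_if_cot_eq\<close>). In particular the square roots never have to be evaluated.
\<close>

section \<open>Dual linear algebra\<close>

lemma dual_inner_right_linear:
  "dual_inner x (y + z) = dual_inner x y + dual_inner x z"
  "dual_inner x (y - z) = dual_inner x y - dual_inner x z"
  "dual_inner x (- y) = - dual_inner x y"
  "dual_inner x (dual_scale a y) = a * dual_inner x y"
  by (simp_all add: dual_inner_def dual_scale_def dual_bilinear_def plus_dual_def minus_dual_def
      uminus_dual_def times_dual_def inner_add_right inner_diff_right algebra_simps)

lemma dual_cross_left_linear:
  "dual_cross (x + y) z = dual_cross x z + dual_cross y z"
  "dual_cross (dual_scale a x) z = dual_scale a (dual_cross x z)"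
  by (simp_all add: dual_cross_def dual_scale_def dual_bilinear_def plus_dual_def
      cross_add_left cross_mult_left algebra_simps)

text \<open>\<open>x \<mapsto> x + \<epsilon> p \<times> x\<close> acts as an infinitesimal rotation, so it preserves inner products
  (the triple products cancel) and cross products (the Jacobi identity). It turns the frame
  vectors of a ruled surface into its dual frame.\<close>

lemma dual_inner_lift:
  "dual_inner (Dual x (cross3 p x)) (Dual y (cross3 p y)) = Dual (x \<bullet> y) 0"
  by (simp add: dual_inner_def dual_bilinear_def)
    (simp add: cross3_def inner_vec_def sum_3 vector_3 algebra_simps)

lemma dual_cross_lift:
  "dual_cross (Dual x (cross3 p x)) (Dual y (cross3 p y))
     = Dual (cross3 x y) (cross3 p (cross3 x y))"
  by (simp add: dual_cross_def dual_bilinear_def)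
    (simp add: cross3_def vec_eq_iff forall_3 vector_3 algebra_simps)

lemma dual_unit_cancel:
  fixes a x :: "real dual"
  assumes "re a \<noteq> 0" "a * x = 0"
  shows "x = 0"
  using assms by (cases a; cases x) (auto simp: times_dual_def dual_bilinear_def zero_dual_def)

section \<open>Dual angles\<close>

text \<open>The real parts agree because \<open>sin (re p - re q) = 0\<close>, where \<open>sin (re p)\<close> and \<open>sin (re q)\<close>
  are positive since sine and cosine have no common zero. The dual part of the equation is then
  linear and forces \<open>du p = - du k / (1 + (re k)\<^sup>2)\<close>.\<close>

lemma dual_angle_eq_if_cot_eq:
  assumes p: "0 \<le> re p" "re p \<le> pi" "dual_cos p = k * dual_sin p"
    and q: "0 \<le> re q" "re q \<le> pi" "dual_cos q = k * dual_sin q"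
  shows "p = q"
proof -
  have ext: "0 < re r \<and> re r < pi \<and> cos (re r) = re k * sin (re r) \<and>
      du r * (1 + (re k)\<^sup>2) = - du k"
    if r: "0 \<le> re r" "re r \<le> pi" "dual_cos r = k * dual_sin r" for r
  proof -
    have c: "cos (re r) = re k * sin (re r)"
      and d: "- (du r * sin (re r)) = re k * (du r * cos (re r)) + du k * sin (re r)"
      using r(3) by (simp_all add: dual_cos_def dual_sin_def dual_extend_def deriv_sin_real
          deriv_cos_real times_dual_def dual_bilinear_def)
    have "sin (re r) \<noteq> 0"
      using c sin_cos_squared_add [of "re r"] by auto
    moreover have "sin (re r) * (du r * (1 + (re k)\<^sup>2)) = sin (re r) * (- du k)"
      using d unfolding c by (simp add: algebra_simps power2_eq_square)
    ultimately have "du r * (1 + (re k)\<^sup>2) = - du k"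
      by (metis mult_left_cancel)
    moreover have "re r \<noteq> 0" "re r \<noteq> pi"
      using \<open>sin (re r) \<noteq> 0\<close> by auto
    ultimately show ?thesis
      using r(1,2) c by simp
  qed
  note P = ext [OF p] and Q = ext [OF q]
  have "sin (re p - re q) = 0"
    using P Q by (simp add: sin_diff)
  moreover have "\<bar>re p - re q\<bar> < pi"
    using P Q by linarith
  ultimately have "re p = re q"
    using sin_eq_0_pi [of "re p - re q"] by (simp add: abs_less_iff)
  moreover have "du p = du q"
  proof -
    have "1 + (re k)\<^sup>2 \<noteq> 0"
      by (metis add_pos_nonneg less_numeral_extra(1,3) zero_le_power2)
    moreover have "du p * (1 + (re k)\<^sup>2) = du q * (1 + (re k)\<^sup>2)"
      using P Q by simp
    ultimately show ?thesis
      by simp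
  qed
  ultimately show ?thesis
    by (cases p; cases q) simp
qed

lemma dual_spherical_radius_cot:
  "dual_cos (dual_spherical_radius c e s)
     = dual_conical_curvature c e s * dual_sin (dual_spherical_radius c e s)"
  by (simp add: dual_spherical_radius_works divide_dual_def)

section \<open>Derivatives of dual curves\<close>

definition has_dual_derivative ::
    "(real \<Rightarrow> (real^3) dual) \<Rightarrow> (real^3) dual \<Rightarrow> real \<Rightarrow> bool" where
  "has_dual_derivative F D s \<longleftrightarrow>
     ((\<lambda>x. re (F x)) has_vector_derivative re D) (at s) \<and>
     ((\<lambda>x. du (F x)) has_vector_derivative du D) (at s)"

lemma has_dual_derivative_unique:
  assumes "has_dual_derivative F D s" "has_dual_derivative F D' s"
  shows "D = D'"
  using assms unfolding has_dual_derivative_def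
  by (auto intro!: dual.expand dest: vector_derivative_unique_at)

lemma has_dual_derivative_transform:
  assumes "has_dual_derivative F D s" "open I" "s \<in> I" "\<And>x. x \<in> I \<Longrightarrow> F x = G x"
  shows "has_dual_derivative G D s"
  using assms unfolding has_dual_derivative_def
  by (auto intro: has_vector_derivative_transform_within_open)

lemma has_dual_derivative_chain:
  assumes "has_dual_derivative F D (\<sigma> s)" "(\<sigma> has_vector_derivative d) (at s)"
  shows "has_dual_derivative (\<lambda>x. F (\<sigma> x)) (dual_scale (Dual d 0) D) s"
  using vector_diff_chain_at [OF assms(2), of "\<lambda>x. re (F x)" "re D"]
    vector_diff_chain_at [OF assms(2), of "\<lambda>x. du (F x)" "du D"] assms(1)
  by (simp add: has_dual_derivative_def dual_scale_def dual_bilinear_def o_def)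

lemma has_dual_derivative_lift:
  assumes c: "(c has_vector_derivative c') (at s)" and x: "(x has_vector_derivative x') (at s)"
  shows "has_dual_derivative (\<lambda>s. Dual (x s) (cross3 (c s) (x s)))
    (Dual x' (cross3 (c s) x' + cross3 c' (x s))) s"
  unfolding has_dual_derivative_def
  using x bounded_bilinear.has_vector_derivative [OF bilinear_conv_bounded_bilinear [THEN iffD1, OF bilinear_cross] c x]
  by simp

section \<open>The dual Darboux frame\<close>

lemma ruled_surface_frame:
  assumes "ruled_surface I c e" "s \<in> I"
  shows "e s \<bullet> e s = 1" "tangent e s \<bullet> tangent e s = 1" "vderiv c s \<bullet> tangent e s = 0"
    "(c has_vector_derivative vderiv c s) (at s)"
proof -
  show "e s \<bullet> e s = 1" "tangent e s \<bullet> tangent e s = 1" "vderiv c s \<bullet> tangent e s = 0"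
    using assms by (auto simp: ruled_surface_def tangent_def)
  have "(vderiv ^^ 0) c differentiable (at s)"
    using assms unfolding ruled_surface_def smooth_on_def by blast
  then show "(c has_vector_derivative vderiv c s) (at s)"
    by (simp add: vector_derivative_works)
qed

lemma frame_cross:
  assumes "ruled_surface I c e" "s \<in> I"
  shows "cross3 (e s) (central_normal e s) = - tangent e s"
    and "cross3 (tangent e s) (central_normal e s) = e s"
  using ruled_surface_frame [OF assms] central_normal_unit(1) [OF assms]
  by (simp_all add: central_normal_def Lagrange inner_commute)

lemma Delta_eq_inner: "Delta c e s = vderiv c s \<bullet> central_normal e s"
  unfolding Delta_def central_normal_def by (rule dot_cross_det [symmetric])

text \<open>Expanding \<open>t = - e \<times> g\<close> and \<open>g = e \<times> t\<close>. The striction condition \<open>c' \<bullet> t = 0\<close> enters in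
  the second identity, where it removes the component along \<open>e\<close>.\<close>

lemma striction_cross:
  assumes "ruled_surface I c e" "s \<in> I"
  shows "cross3 (vderiv c s) (tangent e s)
      = delta c e s *\<^sub>R central_normal e s - Delta c e s *\<^sub>R e s"
    and "cross3 (vderiv c s) (central_normal e s) = - delta c e s *\<^sub>R tangent e s"
proof -
  have t: "tangent e s = - cross3 (e s) (central_normal e s)"
    using frame_cross [OF assms] by simp
  show "cross3 (vderiv c s) (tangent e s)
      = delta c e s *\<^sub>R central_normal e s - Delta c e s *\<^sub>R e s"
    unfolding t by (simp add: cross_minus_right Lagrange Delta_eq_inner delta_def inner_commute)
  show "cross3 (vderiv c s) (central_normal e s) = - delta c e s *\<^sub>R tangent e s"
    using ruled_surface_frame(3) [OF assms]
    by (simp add: central_normal_def Lagrange delta_def)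
qed

text \<open>In this equation and the next one the correction \<open>- \<gamma> \<Delta>\<close> in the dual part of the dual
  conical curvature is what lets the dual speed \<open>1 + \<epsilon> \<Delta>\<close> be factored out:
  \<open>(1 + \<epsilon> \<Delta>) k = \<gamma> + \<epsilon> \<delta>\<close>.\<close>

lemma dual_t_has_dual_derivative:
  assumes "ruled_surface I c e" "s \<in> I"
  shows "has_dual_derivative (dual_t c e)
    (dual_scale (Dual 1 (Delta c e s))
      (dual_scale (dual_conical_curvature c e s) (dual_g c e s) - dual_e c e s)) s"
proof -
  have "has_dual_derivative (dual_t c e)
    (Dual (vderiv (tangent e) s)
      (cross3 (c s) (vderiv (tangent e) s) + cross3 (vderiv c s) (tangent e s))) s"
    using has_dual_derivative_lift [OF ruled_surface_frame(4) [OF assms] central_normal_unit(4) [OF assms]]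
    by (simp add: dual_t_def [abs_def])
  then show ?thesis
    unfolding striction_cross [OF assms] conical_curvature_works [OF assms]
    by (simp add: dual_scale_def dual_bilinear_def dual_conical_curvature_def dual_g_def dual_e_def
        minus_dual_def Cross3.right_diff_distrib cross_mult_right algebra_simps)
qed

lemma dual_g_has_dual_derivative:
  assumes "ruled_surface I c e" "s \<in> I"
  shows "has_dual_derivative (dual_g c e)
    (dual_scale (- (Dual 1 (Delta c e s) * dual_conical_curvature c e s)) (dual_t c e s)) s"
proof -
  note n = central_normal_unit [OF assms]
  have "(central_normal e has_vector_derivative
      (cross3 (e s) (vderiv (tangent e) s) + cross3 (tangent e s) (tangent e s))) (at s)"
    unfolding central_normal_def [abs_def]
    by (rule bounded_bilinear.has_vector_derivative
        [OF bilinear_conv_bounded_bilinear [THEN iffD1, OF bilinear_cross] n(3) n(4)])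
  then have g': "(central_normal e has_vector_derivative
      - conical_curvature e s *\<^sub>R tangent e s) (at s)"
    by (simp add: conical_curvature_works [OF assms] Cross3.right_diff_distrib cross_mult_right
        frame_cross [OF assms])
  have "has_dual_derivative (dual_g c e)
    (Dual (- conical_curvature e s *\<^sub>R tangent e s)
      (cross3 (c s) (- conical_curvature e s *\<^sub>R tangent e s)
        + cross3 (vderiv c s) (central_normal e s))) s"
    using has_dual_derivative_lift [OF ruled_surface_frame(4) [OF assms] g']
    by (simp add: dual_g_def [abs_def])
  then show ?thesis
    unfolding striction_cross [OF assms]
    by (simp add: dual_scale_def dual_bilinear_def dual_conical_curvature_def dual_t_def
        uminus_dual_def times_dual_def cross_minus_right cross_mult_right algebra_simps)
qed

lemma dual_frame_inner:
  assumes "ruled_surface I c e" "s \<in> I"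
  shows "dual_inner (dual_e c e s) (dual_e c e s) = 1"
    and "dual_inner (dual_e c e s) (dual_t c e s) = 0"
  unfolding dual_e_def dual_t_def dual_inner_lift
  using ruled_surface_frame [OF assms] central_normal_unit(1) [OF assms]
  by (simp_all add: one_dual_def zero_dual_def)

lemma dual_frame_cross:
  assumes "ruled_surface I c e" "s \<in> I"
  shows "dual_cross (dual_e c e s) (dual_g c e s) = - dual_t c e s"
    and "dual_cross (dual_t c e s) (dual_g c e s) = dual_e c e s"
  unfolding dual_e_def dual_t_def dual_g_def dual_cross_lift frame_cross [OF assms]
  by (simp_all add: uminus_dual_def cross_minus_right)

section \<open>Mannheim offsets\<close>

text \<open>The \<open>dual_e\<close>-component of the derivative of \<open>dual_g = dual_t\<^sub>1 \<circ> \<sigma>\<close>.\<close>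

lemma mannheim_offset_cot:
  assumes S: "ruled_surface I c e" and S1: "ruled_surface I1 c1 e1"
    and M: "mannheim_offset I c e I1 c1 e1 \<sigma>"
    and A: "dual_offset_angle I c e c1 e1 \<sigma> \<theta>" and s: "s \<in> I"
  shows "dual_cos (\<theta> s) = dual_conical_curvature c1 e1 (\<sigma> s) * dual_sin (\<theta> s)"
proof -
  define k where "k = dual_conical_curvature c1 e1 (\<sigma> s)"
  define w where "w = Dual 1 (Delta c1 e1 (\<sigma> s))"
  define E where "E = dual_e c e s"
  have gt: "\<And>x. x \<in> I \<Longrightarrow> dual_g c e x = dual_t c1 e1 (\<sigma> x)" and \<sigma>': "vderiv \<sigma> s \<noteq> 0"
    and s1: "\<sigma> s \<in> I1"
    using M s by (auto simp: mannheim_offset_def bij_betw_def)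
  have "(vderiv ^^ 0) \<sigma> differentiable (at s)"
    using M s unfolding mannheim_offset_def smooth_on_def by blast
  then have \<sigma>: "(\<sigma> has_vector_derivative vderiv \<sigma> s) (at s)"
    by (simp add: vector_derivative_works)
  have e1: "dual_e c1 e1 (\<sigma> s)
      = dual_scale (dual_cos (\<theta> s)) E + dual_scale (dual_sin (\<theta> s)) (dual_t c e s)"
    using A s by (auto simp: dual_offset_angle_def E_def)
  have g1: "dual_g c1 e1 (\<sigma> s)
      = dual_scale (dual_cos (\<theta> s)) (- dual_t c e s) + dual_scale (dual_sin (\<theta> s)) E"
    unfolding dual_g_eq_cross [of c1] e1 gt [OF s, symmetric]
    by (simp add: dual_cross_left_linear dual_frame_cross [OF S s] E_def)
  have E1: "dual_inner E (dual_e c1 e1 (\<sigma> s)) = dual_cos (\<theta> s)"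
    and G1: "dual_inner E (dual_g c1 e1 (\<sigma> s)) = dual_sin (\<theta> s)"
    unfolding e1 g1 using dual_frame_inner [OF S s]
    by (simp_all add: dual_inner_right_linear E_def)
  have "has_dual_derivative (\<lambda>x. dual_t c1 e1 (\<sigma> x))
      (dual_scale (Dual (vderiv \<sigma> s) 0)
        (dual_scale w (dual_scale k (dual_g c1 e1 (\<sigma> s)) - dual_e c1 e1 (\<sigma> s)))) s"
    unfolding k_def w_def
    by (rule has_dual_derivative_chain [OF dual_t_has_dual_derivative [OF S1 s1] \<sigma>])
  moreover have "has_dual_derivative (\<lambda>x. dual_t c1 e1 (\<sigma> x))
      (dual_scale (- (Dual 1 (Delta c e s) * dual_conical_curvature c e s)) (dual_t c e s)) s"
    using has_dual_derivative_transform [OF dual_g_has_dual_derivative [OF S s] _ s gt] S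
    by (simp add: ruled_surface_def)
  ultimately have "dual_scale (Dual (vderiv \<sigma> s) 0)
        (dual_scale w (dual_scale k (dual_g c1 e1 (\<sigma> s)) - dual_e c1 e1 (\<sigma> s)))
      = dual_scale (- (Dual 1 (Delta c e s) * dual_conical_curvature c e s)) (dual_t c e s)"
    by (rule has_dual_derivative_unique)
  from arg_cong [OF this, of "dual_inner E"]
  have "(Dual (vderiv \<sigma> s) 0 * w) * (k * dual_sin (\<theta> s) - dual_cos (\<theta> s)) = 0"
    using dual_frame_inner(2) [OF S s]
    by (simp add: dual_inner_right_linear E1 G1 mult.assoc E_def [symmetric])
  moreover have "re (Dual (vderiv \<sigma> s) 0 * w) \<noteq> 0"
    using \<sigma>' by (simp add: w_def times_dual_def dual_bilinear_def)
  ultimately have "k * dual_sin (\<theta> s) - dual_cos (\<theta> s) = 0"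
    using dual_unit_cancel by blast
  then show ?thesis
    by (simp add: k_def)
qed

theorem theorem3p7:
  fixes I I1 :: "real set" and c e c1 e1 :: "real \<Rightarrow> real^3"
    and \<sigma> :: "real \<Rightarrow> real" and \<theta> :: "real \<Rightarrow> real dual"
  assumes "ruled_surface I c e"
    and "ruled_surface I1 c1 e1"
    and "mannheim_offset I c e I1 c1 e1 \<sigma>"
    and "dual_offset_angle I c e c1 e1 \<sigma> \<theta>"
  shows "\<forall>s\<in>I. dual_spherical_radius c1 e1 (\<sigma> s) = \<theta> s"
proof
  fix s assume s: "s \<in> I"
  have "0 \<le> re (\<theta> s)" "re (\<theta> s) \<le> pi"
    using assms(4) s by (auto simp: dual_offset_angle_def)
  then show "dual_spherical_radius c1 e1 (\<sigma> s) = \<theta> s"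
    using mannheim_offset_cot [OF assms s]
    by (intro dual_angle_eq_if_cot_eq [OF dual_spherical_radius_works(1,2) dual_spherical_radius_cot])
qed

end
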